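(* Assume that $f'$ exists and is continuous in a neighborhood of $-\theta$, and that $h_n=cn^{-d}$ with $c>0$ and $\frac14<d<\frac12$. If the kernel $k$ is symmetric around the origin, then the standardized $W$ and $\widetilde W$ are equivalent, that is, $$\lim_{n\to\infty}E_\theta\left\{\frac{W-E_\theta(W)}{\sqrt{V_\theta(W)}}-\frac{\widetilde W-E_\theta(\widetilde W)}{\sqrt{V_\theta(\widetilde W)}}\right\}^2=0.$$
   Context: $X_1,X_2,\dots,X_n$ are i.i.d. real random variables with distribution function $F(x-\theta)$, where $\theta\in\mathbb R$ is a fixed location parameter and $F$ has a density $f$ satisfying $f(-x)=f(x)$ for all $x$. $E_\theta$ and $V_\theta$ denote expectation and variance under this model. The kernel $k:\mathbb R\to\mathbb R$ satisfies $\int_{-\infty}^{\infty}k(u)\,du=1$ (it may take negative values), and is called symmetric (around the origin) if $k(-u)=k(u)$. Put $K(t)=\int_{-\infty}^t k(u)\,du$. The bandwidth $h_n>0$ satisfies $h_n\to0$ as $n\to\infty$. Let $\psi(x)=1$ for $x\ge0$ and $\psi(x)=0$ for $x<0$. The Wilcoxon signed rank statistic (in Mann-Whitney form) and its smoothed version are $$W=\sum_{1\le i\le j\le n}\psi(X_i+X_j),\qquad \widetilde W=\frac{n(n+1)}2-\sum_{1\le i\le j\le n}K\Bigl(-\frac{X_i+X_j}{2h_n}\Bigr).$$ *)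

theory Defs
  imports "HOL-Probability.Probability"
begin

definition psi :: "real \<Rightarrow> real" where
  "psi x = (if x \<ge> 0 then 1 else 0)"

definition kernel_cdf :: "(real \<Rightarrow> real) \<Rightarrow> real \<Rightarrow> real" where
  "kernel_cdf k t = (LBINT u:{..t}. k u)"

(* Only the entries X 1, ..., X n of the sequence are used. *)
definition wilcoxon :: "(nat \<Rightarrow> 'a \<Rightarrow> real) \<Rightarrow> nat \<Rightarrow> 'a \<Rightarrow> real" where
  "wilcoxon X n \<omega> = (\<Sum>i=1..n. \<Sum>j=i..n. psi (X i \<omega> + X j \<omega>))"

(* The argument h is the bandwidth for the given sample size n. *)
definition smoothed_wilcoxon ::
  "(real \<Rightarrow> real) \<Rightarrow> real \<Rightarrow> (nat \<Rightarrow> 'a \<Rightarrow> real) \<Rightarrow> nat \<Rightarrow> 'a \<Rightarrow> real" where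
  "smoothed_wilcoxon k h X n \<omega> =
     real n * (real n + 1) / 2 -
     (\<Sum>i=1..n. \<Sum>j=i..n. kernel_cdf k (- ((X i \<omega> + X j \<omega>) / (2 * h))))"

definition standardized :: "'a measure \<Rightarrow> ('a \<Rightarrow> real) \<Rightarrow> 'a \<Rightarrow> real" where
  "standardized M Y \<omega> =
     (Y \<omega> - prob_space.expectation M Y) / sqrt (prob_space.variance M Y)"

end

theory Submission
  imports Defs
begin

text \<open>
  Write \<open>W\<close> for the signed rank statistic and \<open>V\<close> for its smoothed version. Both are sums over index
  pairs of a bounded function of \<open>X i + X j\<close>. Two centred variables that are close in \<open>L\<^sup>2\<close> on the
  scale of the first have almost the same standardization: the mean squared difference of the
  standardized variables is at most \<open>4 * Var (W - V) / Var W\<close> (\<open>standardized_diff_le\<close>). So it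
  suffices that \<open>Var (W - V)\<close> is of smaller order than \<open>n ^ 3\<close> while \<open>Var W\<close> is of order \<open>n ^ 3\<close>.

  \<^bold>\<open>Upper bound.\<close> Up to a constant, \<open>W - V\<close> is the sum over index pairs of the smoothing error at
  \<open>X i + X j\<close>. Terms with disjoint index pairs are uncorrelated, and only \<open>O (n ^ 3)\<close> couples of
  index pairs overlap, so \<open>Var (W - V)\<close> is at most \<open>4 * n ^ 3\<close> times the second moment of a single
  smoothing error (\<open>variance_pair_sum_le\<close>). The smoothing error is bounded and tends to \<open>0\<close> at every
  nonzero argument as the bandwidth shrinks, and the sums \<open>X i + X j\<close> avoid \<open>0\<close> almost surely
  because the observations have no atoms. By dominated convergence the second moment tends to \<open>0\<close>
  (\<open>smoothing_error_second_moment_tendsto_0\<close>).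

  \<^bold>\<open>Lower bound.\<close> Let \<open>\<zeta>\<close> be the variance of \<open>g (X 1)\<close>, where \<open>g x\<close> is the probability of
  \<open>x + X 2 \<ge> 0\<close>. The variance of \<open>W\<close> is at least that of its Hoeffding projection up to lower order,
  which gives \<open>Var W \<ge> n ^ 3 * \<zeta> - O (n ^ 2)\<close> (\<open>variance_wilcoxon_ge\<close>). If \<open>\<zeta>\<close> were \<open>0\<close>, then \<open>g\<close>
  would be almost surely a constant \<open>p\<close>, and a Fubini argument gives \<open>p * (1 - p) = 0\<close>
  (\<open>mean_psi_degenerate\<close>); all indicators in \<open>W\<close> are then almost surely equal to \<open>p\<close>, so \<open>W\<close> has
  variance \<open>0\<close> for every \<open>n\<close> (\<open>variance_wilcoxon_degenerate\<close>), against the nondegeneracy hypothesis.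
\<close>

section \<open>Bounded random variables and standardization\<close>

definition bounded_rv :: "'a measure \<Rightarrow> ('a \<Rightarrow> real) \<Rightarrow> bool" where
  "bounded_rv M Y \<longleftrightarrow> Y \<in> borel_measurable M \<and> (\<exists>B. \<forall>\<omega>. \<bar>Y \<omega>\<bar> \<le> B)"

lemma bounded_rvI: "Y \<in> borel_measurable M \<Longrightarrow> (\<And>\<omega>. \<bar>Y \<omega>\<bar> \<le> B) \<Longrightarrow> bounded_rv M Y"
  by (auto simp: bounded_rv_def)

lemma bounded_rv_const: "bounded_rv M (\<lambda>_. c)"
  by (auto intro: bounded_rvI)

lemma bounded_rv_add:
  assumes "bounded_rv M Y" "bounded_rv M Z"
  shows "bounded_rv M (\<lambda>\<omega>. Y \<omega> + Z \<omega>)"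
proof -
  obtain B C where "\<And>\<omega>. \<bar>Y \<omega>\<bar> \<le> B" "\<And>\<omega>. \<bar>Z \<omega>\<bar> \<le> C"
    using assms unfolding bounded_rv_def by blast
  then have "\<bar>Y \<omega> + Z \<omega>\<bar> \<le> B + C" for \<omega>
    by (meson abs_triangle_ineq add_mono order_trans)
  then show ?thesis
    using assms by (intro bounded_rvI) (auto simp: bounded_rv_def)
qed

lemma bounded_rv_mult:
  assumes "bounded_rv M Y" "bounded_rv M Z"
  shows "bounded_rv M (\<lambda>\<omega>. Y \<omega> * Z \<omega>)"
proof -
  obtain B C where BC: "\<And>\<omega>. \<bar>Y \<omega>\<bar> \<le> B" "\<And>\<omega>. \<bar>Z \<omega>\<bar> \<le> C"
    using assms unfolding bounded_rv_def by blast
  have "\<bar>Y \<omega> * Z \<omega>\<bar> \<le> B * C" for \<omega>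
    unfolding abs_mult by (meson BC abs_ge_zero mult_mono order_trans)
  then show ?thesis
    using assms by (intro bounded_rvI) (auto simp: bounded_rv_def)
qed

lemma bounded_rv_diff:
  assumes "bounded_rv M Y" "bounded_rv M Z"
  shows "bounded_rv M (\<lambda>\<omega>. Y \<omega> - Z \<omega>)"
  using bounded_rv_add[OF assms(1) bounded_rv_mult[OF bounded_rv_const[of M "-1"] assms(2)]] by simp

lemma bounded_rv_power2: "bounded_rv M Y \<Longrightarrow> bounded_rv M (\<lambda>\<omega>. (Y \<omega>)\<^sup>2)"
  unfolding power2_eq_square by (rule bounded_rv_mult)

lemma bounded_rv_sum:
  "(\<And>p. p \<in> P \<Longrightarrow> bounded_rv M (Y p)) \<Longrightarrow> bounded_rv M (\<lambda>\<omega>. \<Sum>p\<in>P. Y p \<omega>)"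
  by (induction P rule: infinite_finite_induct) (auto intro: bounded_rv_add bounded_rv_const)

lemmas bounded_rv_intros =
  bounded_rv_const bounded_rv_add bounded_rv_diff bounded_rv_mult bounded_rv_power2 bounded_rv_sum

context prob_space
begin

lemma integrable_bounded_rv: "bounded_rv M Y \<Longrightarrow> integrable M Y"
  unfolding bounded_rv_def by (metis AE_I2 integrable_const_bound real_norm_def)

lemma variance_bounded_rv:
  assumes "bounded_rv M Y"
  shows "variance Y = expectation (\<lambda>\<omega>. (Y \<omega>)\<^sup>2) - (expectation Y)\<^sup>2"
  by (rule variance_eq) (intro integrable_bounded_rv bounded_rv_intros assms)+

lemma variance_add_const:
  assumes "bounded_rv M Y"
  shows "variance (\<lambda>\<omega>. Y \<omega> + c) = variance Y"
  using integrable_bounded_rv[OF assms] by (simp add: prob_space)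

text \<open>Bounding the covariance by the mean of the two variances, rather than by a product of standard
  deviations, gives a bound that can be summed over all overlapping index pairs at once.\<close>

lemma covariance_le_of_second_moments:
  assumes Y: "bounded_rv M Y" and Z: "bounded_rv M Z"
    and "expectation (\<lambda>\<omega>. (Y \<omega>)\<^sup>2) \<le> e" "expectation (\<lambda>\<omega>. (Z \<omega>)\<^sup>2) \<le> e"
  shows "expectation (\<lambda>\<omega>. (Y \<omega> - expectation Y) * (Z \<omega> - expectation Z)) \<le> e"
proof -
  have am_gm: "x * y \<le> (x\<^sup>2 + y\<^sup>2) / 2" for x y :: real
    using sum_squares_bound[of x y] by simp
  have vY: "variance Y \<le> e"
    unfolding variance_bounded_rv[OF Y] by (rule order_trans[OF _ assms(3)]) simp
  have vZ: "variance Z \<le> e"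
    unfolding variance_bounded_rv[OF Z] by (rule order_trans[OF _ assms(4)]) simp
  have "expectation (\<lambda>\<omega>. (Y \<omega> - expectation Y) * (Z \<omega> - expectation Z))
      \<le> expectation (\<lambda>\<omega>. ((Y \<omega> - expectation Y)\<^sup>2 + (Z \<omega> - expectation Z)\<^sup>2) / 2)"
  proof (rule integral_mono)
    show "integrable M (\<lambda>\<omega>. ((Y \<omega> - expectation Y)\<^sup>2 + (Z \<omega> - expectation Z)\<^sup>2) / 2)"
      using Y Z by (intro integrable_divide_zero integrable_bounded_rv bounded_rv_intros)
    fix \<omega> show "(Y \<omega> - expectation Y) * (Z \<omega> - expectation Z)
        \<le> ((Y \<omega> - expectation Y)\<^sup>2 + (Z \<omega> - expectation Z)\<^sup>2) / 2"
      using am_gm .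
  qed (intro integrable_bounded_rv bounded_rv_intros Y Z)
  also have "\<dots> = (variance Y + variance Z) / 2"
    by (simp, subst Bochner_Integration.integral_add)
       (intro refl integrable_bounded_rv bounded_rv_intros Y Z)+
  also have "\<dots> \<le> e"
    using add_mono[OF vY vZ] by simp
  finally show ?thesis .
qed

lemma variance_sum_eq:
  assumes "finite P" "\<And>p. p \<in> P \<Longrightarrow> bounded_rv M (Y p)"
  shows "variance (\<lambda>\<omega>. \<Sum>p\<in>P. Y p \<omega>) =
    (\<Sum>p\<in>P. \<Sum>q\<in>P. expectation (\<lambda>\<omega>. (Y p \<omega> - expectation (Y p)) * (Y q \<omega> - expectation (Y q))))"
proof -
  have E: "expectation (\<lambda>\<omega>. \<Sum>p\<in>P. Y p \<omega>) = (\<Sum>p\<in>P. expectation (Y p))"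
    by (intro Bochner_Integration.integral_sum integrable_bounded_rv assms)
  have "variance (\<lambda>\<omega>. \<Sum>p\<in>P. Y p \<omega>) =
      expectation (\<lambda>\<omega>. \<Sum>p\<in>P. \<Sum>q\<in>P. (Y p \<omega> - expectation (Y p)) * (Y q \<omega> - expectation (Y q)))"
    unfolding E by (simp add: power2_eq_square sum_product flip: sum_subtractf)
  also have "\<dots> = (\<Sum>p\<in>P. \<Sum>q\<in>P. expectation (\<lambda>\<omega>. (Y p \<omega> - expectation (Y p)) * (Y q \<omega> - expectation (Y q))))"
    by (subst Bochner_Integration.integral_sum,
        intro integrable_bounded_rv bounded_rv_intros assms, assumption+)
       (intro sum.cong refl Bochner_Integration.integral_sum integrable_bounded_rv
          bounded_rv_intros assms, assumption+)
  finally show ?thesis .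
qed

text \<open>In terms of the standard deviations \<open>a\<close>, \<open>b\<close> and the covariance \<open>\<rho>\<close>, the left-hand side is
  \<open>2 - 2 * \<rho> / (a * b)\<close> and the claim becomes an algebraic inequality between these three numbers,
  given \<open>\<bar>\<rho>\<bar> \<le> a * b\<close>. A degenerate \<open>B\<close> is covered too: division by zero makes its
  standardization \<open>0\<close>, so that the left-hand side is \<open>1\<close> while the right-hand side is \<open>4\<close>.\<close>

lemma standardized_diff_le:
  assumes A: "bounded_rv M A" and B: "bounded_rv M B" and pos: "variance A > 0"
  shows "expectation (\<lambda>\<omega>. (standardized M A \<omega> - standardized M B \<omega>)\<^sup>2)
    \<le> 4 * variance (\<lambda>\<omega>. A \<omega> - B \<omega>) / variance A"
proof -
  define a where "a = sqrt (variance A)"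
  define b where "b = sqrt (variance B)"
  define U where "U = (\<lambda>\<omega>. A \<omega> - expectation A)"
  define V where "V = (\<lambda>\<omega>. B \<omega> - expectation B)"
  have bU: "bounded_rv M U" and bV: "bounded_rv M V"
    unfolding U_def V_def by (intro bounded_rv_intros A B)+
  have a: "a > 0" and b: "b \<ge> 0"
    using pos variance_positive[of B] by (auto simp: a_def b_def)
  have a2: "expectation (\<lambda>\<omega>. (U \<omega>)\<^sup>2) = a\<^sup>2" and b2: "expectation (\<lambda>\<omega>. (V \<omega>)\<^sup>2) = b\<^sup>2"
    using pos variance_positive[of B] by (auto simp: a_def b_def U_def V_def)
  define \<rho> where "\<rho> = expectation (\<lambda>\<omega>. U \<omega> * V \<omega>)"
  have quad: "expectation (\<lambda>\<omega>. (s * U \<omega> - t * V \<omega>)\<^sup>2) = s\<^sup>2 * a\<^sup>2 - 2 * s * t * \<rho> + t\<^sup>2 * b\<^sup>2" for s t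
  proof -
    have "expectation (\<lambda>\<omega>. (s * U \<omega> - t * V \<omega>)\<^sup>2) =
        expectation (\<lambda>\<omega>. (s\<^sup>2 * (U \<omega>)\<^sup>2 + (- 2 * s * t) * (U \<omega> * V \<omega>)) + t\<^sup>2 * (V \<omega>)\<^sup>2)"
      by (intro Bochner_Integration.integral_cong refl) (simp add: power2_eq_square algebra_simps)
    also have "\<dots> = s\<^sup>2 * a\<^sup>2 - 2 * s * t * \<rho> + t\<^sup>2 * b\<^sup>2"
      by (subst Bochner_Integration.integral_add,
          (intro integrable_bounded_rv bounded_rv_intros bU bV)+,
          subst Bochner_Integration.integral_add,
          (intro integrable_bounded_rv bounded_rv_intros bU bV)+) (simp add: a2 b2 \<rho>_def)
    finally show ?thesis .
  qed
  have nonneg: "0 \<le> s\<^sup>2 * a\<^sup>2 - 2 * s * t * \<rho> + t\<^sup>2 * b\<^sup>2" for s t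
    unfolding quad[symmetric] by (intro Bochner_Integration.integral_nonneg) simp
  have "expectation (\<lambda>\<omega>. A \<omega> - B \<omega>) = expectation A - expectation B"
    by (intro Bochner_Integration.integral_diff integrable_bounded_rv A B)
  then have "(\<lambda>\<omega>. (A \<omega> - B \<omega>) - expectation (\<lambda>\<omega>. A \<omega> - B \<omega>)) = (\<lambda>\<omega>. 1 * U \<omega> - 1 * V \<omega>)"
    by (simp add: U_def V_def fun_eq_iff)
  then have D: "variance (\<lambda>\<omega>. A \<omega> - B \<omega>) = a\<^sup>2 - 2 * \<rho> + b\<^sup>2"
    using quad[of 1 1] by (simp add: fun_eq_iff)
  have std: "expectation (\<lambda>\<omega>. (standardized M A \<omega> - standardized M B \<omega>)\<^sup>2)
      = (1/a)\<^sup>2 * a\<^sup>2 - 2 * (1/a) * (1/b) * \<rho> + (1/b)\<^sup>2 * b\<^sup>2"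
    using quad[of "1/a" "1/b"] by (simp add: standardized_def a_def b_def U_def V_def)
  \<comment> \<open>The Cauchy--Schwarz inequality, read off from nonnegative values of the quadratic form.\<close>
  have cs: "\<rho> \<le> a * b"
  proof (cases "b = 0")
    case True
    then have "2 * t * \<rho> \<le> a\<^sup>2" for t
      using nonneg[of 1 t] by simp
    from this[of "(a\<^sup>2 + 1) / (2 * \<rho>)"] show ?thesis using True by (cases "\<rho> = 0") auto
  next
    case False
    then show ?thesis
      using nonneg[of "1/a" "1/b"] a b by (simp add: field_simps)
  qed
  have "(1/a)\<^sup>2 * a\<^sup>2 - 2 * (1/a) * (1/b) * \<rho> + (1/b)\<^sup>2 * b\<^sup>2 \<le> 4 * (a\<^sup>2 - 2 * \<rho> + b\<^sup>2) / a\<^sup>2"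
  proof (cases "b = 0")
    case True
    then show ?thesis using a cs zero_le_power2[of a] by (simp add: field_simps; linarith)
  next
    case False
    then have b: "b > 0" using b by simp
    have "- \<rho> \<le> a * b"
      using nonneg[of "1/a" "-1/b"] a b by (simp add: field_simps)
    define D where "D = a\<^sup>2 - 2 * \<rho> + b\<^sup>2"
    have "(a - b)\<^sup>2 \<le> D" "D \<le> (a + b)\<^sup>2"
      using cs \<open>- \<rho> \<le> a * b\<close> by (auto simp: D_def power2_eq_square algebra_simps)
    \<comment> \<open>For \<open>b\<close> comparable with \<open>a\<close> dropping the square is enough; for small \<open>b\<close> the left-hand
      side is controlled by the largest possible \<open>D\<close>, namely \<open>(a + b)\<^sup>2\<close>.\<close>
    have "a * (D - (a - b)\<^sup>2) \<le> 4 * D * b"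
    proof (cases "a \<le> 4 * b")
      case True
      have "a * (D - (a - b)\<^sup>2) \<le> a * D" using a by simp
      also have "\<dots> \<le> 4 * b * D"
        using True \<open>(a - b)\<^sup>2 \<le> D\<close> zero_le_power2[of "a - b"] by (intro mult_right_mono) linarith+
      finally show ?thesis by (simp add: mult_ac)
    next
      case False
      then have "(a - 4 * b) * D \<le> (a - 4 * b) * (a + b)\<^sup>2"
        using \<open>D \<le> (a + b)\<^sup>2\<close> by (intro mult_left_mono) auto
      also have "\<dots> = a * (a - b)\<^sup>2 - b\<^sup>2 * (8 * a + 4 * b)"
        by (simp add: power2_eq_square algebra_simps)
      also have "\<dots> \<le> a * (a - b)\<^sup>2" using a b by simp
      finally show ?thesis by (simp add: algebra_simps)
    qed
    moreover have "(1/a)\<^sup>2 * a\<^sup>2 - 2 * (1/a) * (1/b) * \<rho> + (1/b)\<^sup>2 * b\<^sup>2 = (D - (a - b)\<^sup>2) / (a * b)"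
      using a b by (simp add: D_def field_simps power2_eq_square)
    moreover have "(D - (a - b)\<^sup>2) / (a * b) = (a * (D - (a - b)\<^sup>2)) / (a\<^sup>2 * b)"
      using a b by (simp add: power2_eq_square)
    moreover have "4 * D / a\<^sup>2 = 4 * D * b / (a\<^sup>2 * b)" using a b by simp
    ultimately show ?thesis
      using divide_right_mono[of "a * (D - (a - b)\<^sup>2)" "4 * D * b" "a\<^sup>2 * b"] b
      unfolding D_def[symmetric] by simp
  qed
  then show ?thesis
    unfolding std D using a pos by (simp add: a_def)
qed

end

section \<open>Sums over pairs of independent observations\<close>

definition index_pairs :: "nat \<Rightarrow> (nat \<times> nat) set" where
  "index_pairs n = (SIGMA i:{1..n}. {i..n})"

lemma finite_index_pairs [simp]: "finite (index_pairs n)"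
  by (simp add: index_pairs_def)

lemma mem_index_pairs: "(i, j) \<in> index_pairs n \<longleftrightarrow> 1 \<le> i \<and> i \<le> j \<and> j \<le> n"
  by (auto simp: index_pairs_def)

lemma card_index_pairs_le: "card (index_pairs n) \<le> n * n"
proof -
  have "card (index_pairs n) \<le> card ({1..n} \<times> {1..n})"
    by (rule card_mono) (auto simp: index_pairs_def)
  then show ?thesis by (simp add: card_cartesian_product)
qed

lemma card_overlapping_index_pairs_le:
  "card {q \<in> index_pairs n. {i, j} \<inter> {fst q, snd q} \<noteq> {}} \<le> 4 * n"
proof -
  have "{q \<in> index_pairs n. {i, j} \<inter> {fst q, snd q} \<noteq> {}}
      \<subseteq> {i, j} \<times> {1..n} \<union> {1..n} \<times> {i, j}"
    by (auto simp: index_pairs_def)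
  then have "card {q \<in> index_pairs n. {i, j} \<inter> {fst q, snd q} \<noteq> {}}
      \<le> card ({i, j} \<times> {1..n} \<union> {1..n} \<times> {i, j})"
    by (rule card_mono[rotated]) simp
  also have "\<dots> \<le> card ({i, j} \<times> {1..n}) + card ({1..n} \<times> {i, j})"
    by (rule card_Un_le)
  also have "\<dots> = 2 * card {i, j} * n"
    by (simp add: card_cartesian_product)
  also have "\<dots> \<le> 2 * 2 * n"
    by (intro mult_mono) (auto simp: card_insert_if)
  finally show ?thesis by simp
qed

lemma sum_index_pairs: "(\<Sum>i=1..n. \<Sum>j=i..n. g i j) = (\<Sum>(i, j)\<in>index_pairs n. g i j)"
  unfolding index_pairs_def by (rule sum.Sigma) auto

text \<open>Only the observations with index at least \<open>1\<close> belong to the sample, so \<open>X 0\<close> is left arbitrary,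
  even with regard to measurability.\<close>

locale iid_sample = prob_space M for M :: "'a measure" +
  fixes X :: "nat \<Rightarrow> 'a \<Rightarrow> real" and \<mu> :: "real measure"
  assumes indep: "indep_vars (\<lambda>_. borel) X {1..}"
    and law: "\<And>i. i \<ge> 1 \<Longrightarrow> distr M borel (X i) = \<mu>"
begin

lemma measurable_obs [measurable]: "i \<ge> 1 \<Longrightarrow> X i \<in> borel_measurable M"
  using indep by (auto simp: indep_vars_def)

lemma prob_space_law: "prob_space \<mu>"
  using law[of 1] measurable_obs[of 1] prob_space_distr[of "X 1" borel] by simp

lemma sets_law [simp, measurable_cong]: "sets \<mu> = sets borel"
  using law[of 1, symmetric] by simp

lemma space_law [simp]: "space \<mu> = UNIV"
  using law[of 1, symmetric] by simp

sublocale law: prob_space \<mu>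
  by (rule prob_space_law)

lemma measure_law_UNIV [simp]: "measure \<mu> UNIV = 1"
  using law.prob_space by simp

sublocale law2: pair_prob_space \<mu> \<mu> ..

lemma expectation_obs:
  fixes u :: "real \<Rightarrow> real"
  assumes "i \<ge> 1" "u \<in> borel_measurable borel"
  shows "expectation (\<lambda>\<omega>. u (X i \<omega>)) = (\<integral>x. u x \<partial>\<mu>)"
  unfolding law[OF assms(1), symmetric]
  using assms by (simp add: integral_distr measurable_obs)

lemma distr_pair:
  assumes "i \<ge> 1" "j \<ge> 1" "i \<noteq> j"
  shows "distr M (borel \<Otimes>\<^sub>M borel) (\<lambda>\<omega>. (X i \<omega>, X j \<omega>)) = \<mu> \<Otimes>\<^sub>M \<mu>"
proof -
  have "indep_var borel (X i) borel (X j)"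
    using indep_var_compose[OF indep_var_restrict[OF indep, of "{i}" "{j}"],
        of "\<lambda>v. v i" borel "\<lambda>v. v j" borel] assms
    by (simp add: o_def)
  then show ?thesis
    using law assms by (simp add: indep_var_distribution_eq)
qed

lemma expectation_pair:
  assumes "i \<ge> 1" "j \<ge> 1" "i \<noteq> j"
    and a: "a \<in> borel_measurable (borel \<Otimes>\<^sub>M borel)" "\<And>z. \<bar>a z :: real\<bar> \<le> B"
  shows "expectation (\<lambda>\<omega>. a (X i \<omega>, X j \<omega>)) = (\<integral>x. (\<integral>y. a (x, y) \<partial>\<mu>) \<partial>\<mu>)"
proof -
  have *: "a \<in> borel_measurable (\<mu> \<Otimes>\<^sub>M \<mu>)"
    using a(1) by simp
  have "expectation (\<lambda>\<omega>. a (X i \<omega>, X j \<omega>))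
      = integral\<^sup>L (distr M (borel \<Otimes>\<^sub>M borel) (\<lambda>\<omega>. (X i \<omega>, X j \<omega>))) a"
    using assms by (simp add: integral_distr measurable_obs)
  also have "\<dots> = integral\<^sup>L (\<mu> \<Otimes>\<^sub>M \<mu>) a"
    by (simp only: distr_pair[OF assms(1-3)])
  also have "\<dots> = (\<integral>x. (\<integral>y. a (x, y) \<partial>\<mu>) \<partial>\<mu>)"
    using * a(2) by (intro law2.integral_fst'[symmetric] law2.P.integrable_const_bound[of _ B]) auto
  finally show ?thesis .
qed

text \<open>The two index pairs may be degenerate (\<open>i = j\<close> or \<open>k = l\<close>), so that the lemma also separates a pair
  from a single observation, and one observation from another.\<close>

lemma expectation_disjoint_pairs:
  assumes "i \<ge> 1" "j \<ge> 1" "k \<ge> 1" "l \<ge> 1" "{i, j} \<inter> {k, l} = {}"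
    and a: "a \<in> borel_measurable (borel \<Otimes>\<^sub>M borel)" "\<And>z. \<bar>a z :: real\<bar> \<le> A"
    and b: "b \<in> borel_measurable (borel \<Otimes>\<^sub>M borel)" "\<And>z. \<bar>b z :: real\<bar> \<le> B"
  shows "expectation (\<lambda>\<omega>. a (X i \<omega>, X j \<omega>) * b (X k \<omega>, X l \<omega>))
    = expectation (\<lambda>\<omega>. a (X i \<omega>, X j \<omega>)) * expectation (\<lambda>\<omega>. b (X k \<omega>, X l \<omega>))"
proof (rule indep_var_lebesgue_integral)
  have "indep_var borel ((\<lambda>v. a (v i, v j)) \<circ> (\<lambda>\<omega>. restrict (\<lambda>i. X i \<omega>) {i, j}))
      borel ((\<lambda>v. b (v k, v l)) \<circ> (\<lambda>\<omega>. restrict (\<lambda>i. X i \<omega>) {k, l}))"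
  proof (rule indep_var_compose[OF indep_var_restrict[OF indep]])
    show "(\<lambda>v. a (v i, v j)) \<in> borel_measurable (Pi\<^sub>M {i, j} (\<lambda>_. borel))"
      using a(1) by measurable
    show "(\<lambda>v. b (v k, v l)) \<in> borel_measurable (Pi\<^sub>M {k, l} (\<lambda>_. borel))"
      using b(1) by measurable
  qed (use assms in auto)
  then show "indep_var borel (\<lambda>\<omega>. a (X i \<omega>, X j \<omega>)) borel (\<lambda>\<omega>. b (X k \<omega>, X l \<omega>))"
    by (simp add: o_def)
  show "integrable M (\<lambda>\<omega>. a (X i \<omega>, X j \<omega>))"
    using assms by (intro integrable_const_bound[of _ A]) auto
  show "integrable M (\<lambda>\<omega>. b (X k \<omega>, X l \<omega>))"
    using assms by (intro integrable_const_bound[of _ B]) auto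
qed

text \<open>In the expansion of the variance as a double sum of covariances, a couple of disjoint index pairs
  contributes nothing. Each of the at most \<open>n\<^sup>2\<close> index pairs overlaps at most \<open>4 * n\<close> others, and each
  overlapping couple contributes at most \<open>e\<close>. Diagonal and off-diagonal sums have different laws,
  hence the two moment hypotheses.\<close>

lemma variance_pair_sum_le:
  assumes u [measurable]: "u \<in> borel_measurable borel" and B: "\<And>s. \<bar>u s\<bar> \<le> B"
    and e1: "expectation (\<lambda>\<omega>. (u (X 1 \<omega> + X 1 \<omega>))\<^sup>2) \<le> e"
    and e2: "expectation (\<lambda>\<omega>. (u (X 1 \<omega> + X 2 \<omega>))\<^sup>2) \<le> e"
  shows "variance (\<lambda>\<omega>. \<Sum>(i, j)\<in>index_pairs n. u (X i \<omega> + X j \<omega>)) \<le> 4 * e * real n ^ 3"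
proof -
  define Y where "Y = (\<lambda>(i, j) \<omega>. u (X i \<omega> + X j \<omega>))"
  have bounded: "bounded_rv M (Y p)" if "p \<in> index_pairs n" for p
    using that by (cases p) (auto simp: Y_def mem_index_pairs intro!: bounded_rvI[OF _ B])
  have second_moment: "expectation (\<lambda>\<omega>. (Y p \<omega>)\<^sup>2) \<le> e" if p: "p \<in> index_pairs n" for p
  proof -
    obtain i j where ij: "p = (i, j)" "i \<ge> 1" "j \<ge> 1"
      using p by (cases p) (auto simp: mem_index_pairs)
    have u2: "\<bar>(u s)\<^sup>2\<bar> \<le> B\<^sup>2" for s
      using power_mono[OF B[of s], of 2] by simp
    show ?thesis
    proof (cases "i = j")
      case True
      then show ?thesis
        using e1 expectation_obs[of i "\<lambda>x. (u (x + x))\<^sup>2"] expectation_obs[of 1 "\<lambda>x. (u (x + x))\<^sup>2"] ij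
        by (simp add: Y_def)
    next
      case False
      then show ?thesis
        using e2 expectation_pair[of i j "\<lambda>(x, y). (u (x + y))\<^sup>2" "B\<^sup>2"]
          expectation_pair[of 1 2 "\<lambda>(x, y). (u (x + y))\<^sup>2" "B\<^sup>2"] ij u2
        by (simp add: Y_def split_beta)
    qed
  qed
  have e: "e \<ge> 0"
    by (rule order_trans[OF Bochner_Integration.integral_nonneg e2]) simp
  define cov where
    "cov = (\<lambda>p q. expectation (\<lambda>\<omega>. (Y p \<omega> - expectation (Y p)) * (Y q \<omega> - expectation (Y q))))"
  have cov_le: "cov p q \<le> e" if "p \<in> index_pairs n" "q \<in> index_pairs n" for p q
    unfolding cov_def
    by (intro covariance_le_of_second_moments bounded second_moment that)
  have cov_0: "cov p q = 0"
    if pq: "p \<in> index_pairs n" "q \<in> index_pairs n" "{fst p, snd p} \<inter> {fst q, snd q} = {}" for p q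
  proof -
    define E where "E = (\<lambda>p. expectation (Y p))"
    obtain i j k l where ij: "p = (i, j)" "q = (k, l)" "i \<ge> 1" "j \<ge> 1" "k \<ge> 1" "l \<ge> 1"
      using pq by (cases p; cases q) (auto simp: mem_index_pairs)
    have bnd: "\<bar>u s - c\<bar> \<le> B + \<bar>c\<bar>" for s c using B[of s] by linarith
    have "cov p q = expectation (\<lambda>\<omega>. Y p \<omega> - E p) * expectation (\<lambda>\<omega>. Y q \<omega> - E q)"
      using expectation_disjoint_pairs[of i j k l "\<lambda>(x, y). u (x + y) - E p" "B + \<bar>E p\<bar>"
         "\<lambda>(x, y). u (x + y) - E q" "B + \<bar>E q\<bar>"] ij pq(3) bnd
      by (simp add: cov_def Y_def E_def split_beta)
    moreover have "expectation (\<lambda>\<omega>. Y p \<omega> - E p) = 0"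
      using integrable_bounded_rv[OF bounded[OF pq(1)]] by (simp add: E_def prob_space)
    ultimately show ?thesis by simp
  qed
  have "variance (\<lambda>\<omega>. \<Sum>(i, j)\<in>index_pairs n. u (X i \<omega> + X j \<omega>)) = variance (\<lambda>\<omega>. \<Sum>p\<in>index_pairs n. Y p \<omega>)"
    by (simp add: Y_def split_beta)
  also have "\<dots> = (\<Sum>p\<in>index_pairs n. \<Sum>q\<in>index_pairs n. cov p q)"
    unfolding cov_def by (intro variance_sum_eq bounded) auto
  also have "\<dots> \<le> (\<Sum>p\<in>index_pairs n. 4 * real n * e)"
  proof (rule sum_mono)
    fix p assume p: "p \<in> index_pairs n"
    let ?Q = "{q \<in> index_pairs n. {fst p, snd p} \<inter> {fst q, snd q} \<noteq> {}}"
    have "(\<Sum>q\<in>index_pairs n. cov p q) = (\<Sum>q\<in>?Q. cov p q)"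
      using cov_0[OF p] by (intro sum.mono_neutral_right) auto
    also have "\<dots> \<le> real (card ?Q) * e"
      using cov_le[OF p] by (intro sum_bounded_above) auto
    also have "\<dots> \<le> real (4 * n) * e"
      by (intro mult_right_mono e of_nat_mono card_overlapping_index_pairs_le)
    finally show "(\<Sum>q\<in>index_pairs n. cov p q) \<le> 4 * real n * e" by simp
  qed
  also have "\<dots> \<le> real (n * n) * (4 * real n * e)"
    using e card_index_pairs_le[of n]
    by (simp only: sum_constant) (intro mult_right_mono of_nat_mono; simp)
  finally show ?thesis by (simp add: power3_eq_cube mult_ac)
qed

end

section \<open>Variance of the signed rank statistic\<close>

lemma psi_measurable [measurable]: "psi \<in> borel_measurable borel"
  unfolding psi_def by measurable

lemma psi_bounds: "0 \<le> psi x" "psi x \<le> 1" "\<bar>psi x\<bar> \<le> 1"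
  by (auto simp: psi_def)

lemma psi_power2: "(psi x)\<^sup>2 = psi x"
  by (simp add: psi_def)

lemma psi_double: "psi (x + x) = psi x"
  by (simp add: psi_def)

lemma wilcoxon_eq_pair_sum:
  "wilcoxon X n \<omega> = (\<Sum>(i, j)\<in>index_pairs n. psi (X i \<omega> + X j \<omega>))"
  unfolding wilcoxon_def sum_index_pairs ..

context iid_sample
begin

text \<open>The conditional expectation of \<open>psi (X i + X j)\<close> given \<open>X i = x\<close>, for \<open>i \<noteq> j\<close>: the kernel of
  the Hoeffding projection.\<close>

definition proj :: "real \<Rightarrow> real" where
  "proj x = (\<integral>y. psi (x + y) \<partial>\<mu>)"

definition mean_psi :: real where
  "mean_psi = (\<integral>x. proj x \<partial>\<mu>)"

definition proj_variance :: real where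
  "proj_variance = (\<integral>x. (proj x - mean_psi)\<^sup>2 \<partial>\<mu>)"

lemma measurable_proj [measurable]: "proj \<in> borel_measurable borel"
  unfolding proj_def by measurable

lemma law_integrable_bounded:
  "u \<in> borel_measurable borel \<Longrightarrow> (\<And>x. \<bar>u x :: real\<bar> \<le> B) \<Longrightarrow> integrable \<mu> u"
  by (intro law.integrable_const_bound[of _ B]) auto

lemma proj_bounds: "0 \<le> proj x" "proj x \<le> 1"
proof -
  show "0 \<le> proj x"
    unfolding proj_def by (intro Bochner_Integration.integral_nonneg psi_bounds)
  have "proj x \<le> (\<integral>y. 1 \<partial>\<mu>)"
    unfolding proj_def
    by (intro integral_mono law_integrable_bounded[of _ 1]) (auto simp: psi_bounds)
  then show "proj x \<le> 1" by simp
qed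

lemma integrable_proj: "integrable \<mu> proj"
proof (rule law_integrable_bounded)
  show "\<bar>proj x\<bar> \<le> 1" for x
    using proj_bounds[of x] by simp
qed measurable

lemma mean_psi_bounds: "0 \<le> mean_psi" "mean_psi \<le> 1"
proof -
  show "0 \<le> mean_psi"
    unfolding mean_psi_def by (intro Bochner_Integration.integral_nonneg proj_bounds)
  have "mean_psi \<le> (\<integral>y. 1 \<partial>\<mu>)"
    unfolding mean_psi_def
    by (intro integral_mono integrable_proj) (auto simp: proj_bounds)
  then show "mean_psi \<le> 1" by simp
qed

lemma centred_proj_bound: "\<bar>proj x - mean_psi\<bar> \<le> 1"
  using proj_bounds[of x] mean_psi_bounds by linarith

lemma integral_centred_proj: "(\<integral>x. proj x - mean_psi \<partial>\<mu>) = 0"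
  by (simp add: integrable_proj mean_psi_def)

lemma integrable_centred_proj_power2: "integrable \<mu> (\<lambda>x. (proj x - mean_psi)\<^sup>2)"
  by (intro law_integrable_bounded[of _ 1]) (auto simp: abs_square_le_1 centred_proj_bound)

lemma expectation_psi_pair:
  assumes "i \<ge> 1" "j \<ge> 1" "i \<noteq> j"
  shows "expectation (\<lambda>\<omega>. psi (X i \<omega> + X j \<omega>)) = mean_psi"
  using expectation_pair[OF assms, of "\<lambda>(x, y). psi (x + y)" 1]
  by (simp add: split_beta psi_bounds mean_psi_def proj_def)

text \<open>Conditioning on \<open>X i\<close> replaces the indicator by \<open>proj (X i)\<close>; subtracting the mean from that factor as
  well leaves the expectation unchanged.\<close>

lemma expectation_psi_times_proj:
  assumes "i \<ge> 1" "j \<ge> 1" "i \<noteq> j"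
  shows "expectation (\<lambda>\<omega>. psi (X i \<omega> + X j \<omega>) * (proj (X i \<omega>) - mean_psi)) = proj_variance"
proof -
  have bnd: "\<bar>psi s * (proj x - mean_psi)\<bar> \<le> 1" for s x
    using mult_mono[OF psi_bounds(3)[of s] centred_proj_bound[of x]] by (simp add: abs_mult)
  have "expectation (\<lambda>\<omega>. psi (X i \<omega> + X j \<omega>) * (proj (X i \<omega>) - mean_psi))
      = (\<integral>x. proj x * (proj x - mean_psi) \<partial>\<mu>)"
    using expectation_pair[OF assms, of "\<lambda>(x, y). psi (x + y) * (proj x - mean_psi)" 1] bnd
    by (simp add: split_beta proj_def)
  also have "\<dots> = (\<integral>x. (proj x - mean_psi)\<^sup>2 + mean_psi * (proj x - mean_psi) \<partial>\<mu>)"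
    by (intro Bochner_Integration.integral_cong) (auto simp: power2_eq_square algebra_simps)
  also have "\<dots> = proj_variance"
    using integrable_centred_proj_power2 integrable_proj integral_centred_proj
    by (subst Bochner_Integration.integral_add) (auto simp: proj_variance_def)
  finally show ?thesis .
qed

text \<open>Let \<open>S\<close> be the sum of the centred projections. The leading part of the centred statistic is \<open>n * S\<close>,
  and expanding the inequality \<open>0 \<le> E (W - E W - n * S)\<^sup>2\<close> gives
  \<open>Var W \<ge> 2 * n * E (W * S) - n\<^sup>2 * E S\<^sup>2\<close>. Here \<open>E S\<^sup>2\<close> is \<open>n * proj_variance\<close>, and every
  off-diagonal term of \<open>W\<close> contributes \<open>2 * proj_variance\<close> to \<open>E (W * S)\<close>, half of it through each
  of its two indices. The \<open>n\<close> diagonal terms are only estimated from below, by \<open>- 1\<close> each.\<close>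

lemma variance_wilcoxon_ge:
  "variance (wilcoxon X n) \<ge> real n ^ 3 * proj_variance - 2 * (real n)\<^sup>2 * (proj_variance + 1)"
proof -
  define s where "s = (\<lambda>m \<omega>. proj (X m \<omega>) - mean_psi)"
  define S where "S = (\<lambda>\<omega>. \<Sum>m=1..n. s m \<omega>)"
  define Y where "Y = (\<lambda>p \<omega>. psi (X (fst p) \<omega> + X (snd p) \<omega>))"
  define W where "W = (\<lambda>\<omega>. \<Sum>p\<in>index_pairs n. Y p \<omega>)"
  have bs: "bounded_rv M (s m)" if "m \<in> {1..n}" for m
    using that centred_proj_bound unfolding s_def by (intro bounded_rvI[of _ _ 1]) auto
  have bY: "bounded_rv M (Y p)" if "p \<in> index_pairs n" for p
    using that psi_bounds(3) unfolding Y_def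
    by (intro bounded_rvI[of _ _ 1]; cases p) (auto simp: mem_index_pairs)
  have bS: "bounded_rv M S" and bW: "bounded_rv M W"
    unfolding S_def W_def by (intro bounded_rv_sum bs bY; assumption)+
  have Es: "expectation (s m) = 0" if "m \<in> {1..n}" for m
    using that integral_centred_proj expectation_obs[of m "\<lambda>x. proj x - mean_psi"]
    by (simp add: s_def)
  have ES: "expectation S = 0"
    unfolding S_def
    using bs Es by (subst Bochner_Integration.integral_sum) (simp_all add: integrable_bounded_rv)
  have Ess: "expectation (\<lambda>\<omega>. s m \<omega> * s l \<omega>) = (if m = l then proj_variance else 0)"
    if m: "m \<in> {1..n}" and l: "l \<in> {1..n}" for m l
  proof (cases "m = l")
    case True
    then show ?thesis
      using m expectation_obs[of m "\<lambda>x. (proj x - mean_psi)\<^sup>2"]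
      by (simp add: s_def proj_variance_def power2_eq_square)
  next
    case False
    then show ?thesis
      using m l expectation_disjoint_pairs[of m m l l "\<lambda>(x, y). proj x - mean_psi" 1
          "\<lambda>(x, y). proj x - mean_psi" 1] centred_proj_bound Es[OF m]
      by (simp add: s_def split_beta)
  qed
  have ES2: "expectation (\<lambda>\<omega>. (S \<omega>)\<^sup>2) = real n * proj_variance"
  proof -
    have "expectation (\<lambda>\<omega>. (S \<omega>)\<^sup>2) = variance S"
      by (simp add: ES)
    also have "\<dots> = (\<Sum>m=1..n. \<Sum>l=1..n. if m = l then proj_variance else 0)"
      unfolding S_def using bs
      by (subst variance_sum_eq) (auto intro!: sum.cong simp: Es Ess)
    finally show ?thesis by (simp add: sum.delta)
  qed
  have EYs0: "expectation (\<lambda>\<omega>. Y (i, j) \<omega> * s m \<omega>) = 0"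
    if "(i, j) \<in> index_pairs n" "m \<in> {1..n}" "m \<notin> {i, j}" for i j m
    using that expectation_disjoint_pairs[of i j m m "\<lambda>(x, y). psi (x + y)" 1
        "\<lambda>(x, y). proj x - mean_psi" 1] centred_proj_bound psi_bounds(3) Es[OF that(2)]
    by (auto simp: Y_def s_def split_beta mem_index_pairs)
  have EYs_lower: "(\<Sum>m=1..n. expectation (\<lambda>\<omega>. Y (i, j) \<omega> * s m \<omega>))
      \<ge> (if i = j then - 1 else 2 * proj_variance)" if ij: "(i, j) \<in> index_pairs n" for i j
  proof -
    have "(\<Sum>m=1..n. expectation (\<lambda>\<omega>. Y (i, j) \<omega> * s m \<omega>))
        = (\<Sum>m\<in>{i, j}. expectation (\<lambda>\<omega>. Y (i, j) \<omega> * s m \<omega>))"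
      using ij EYs0[OF ij] by (intro sum.mono_neutral_right) (auto simp: mem_index_pairs)
    also have "\<dots> \<ge> (if i = j then - 1 else 2 * proj_variance)"
    proof (cases "i = j")
      case True
      have "expectation (\<lambda>\<omega>. - 1) \<le> expectation (\<lambda>\<omega>. Y (i, j) \<omega> * s i \<omega>)"
      proof (rule integral_mono)
        show "integrable M (\<lambda>\<omega>. Y (i, j) \<omega> * s i \<omega>)"
          using ij by (intro integrable_bounded_rv bounded_rv_mult bY bs) (auto simp: mem_index_pairs)
        fix \<omega>
        have "\<bar>Y (i, j) \<omega> * s i \<omega>\<bar> \<le> 1 * 1"
          unfolding abs_mult Y_def s_def by (intro mult_mono psi_bounds centred_proj_bound) auto
        then show "- 1 \<le> Y (i, j) \<omega> * s i \<omega>" by linarith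
      qed simp
      then show ?thesis using True by (simp add: prob_space)
    next
      case False
      then show ?thesis
        using ij expectation_psi_times_proj[of i j] expectation_psi_times_proj[of j i]
        by (simp add: Y_def s_def mem_index_pairs add.commute)
    qed
    finally show ?thesis .
  qed
  have EWS: "expectation (\<lambda>\<omega>. W \<omega> * S \<omega>) \<ge> proj_variance * (real n)\<^sup>2 - real n * (proj_variance + 1)"
  proof -
    have gauss: "(\<Sum>i=Suc 0..m. real i) = real m * (real m + 1) / 2" for m
      by (induction m) (auto simp: field_simps)
    have "expectation (\<lambda>\<omega>. W \<omega> * S \<omega>) = expectation (\<lambda>\<omega>. \<Sum>p\<in>index_pairs n. \<Sum>m=1..n. Y p \<omega> * s m \<omega>)"
      by (simp add: W_def S_def sum_product)
    also have "\<dots> = (\<Sum>p\<in>index_pairs n. \<Sum>m=1..n. expectation (\<lambda>\<omega>. Y p \<omega> * s m \<omega>))"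
      by (subst Bochner_Integration.integral_sum,
          intro integrable_bounded_rv bounded_rv_intros bs bY, assumption+)
         (intro sum.cong refl Bochner_Integration.integral_sum integrable_bounded_rv
            bounded_rv_intros bs bY, assumption+)
    also have "\<dots> \<ge> (\<Sum>p\<in>index_pairs n. if fst p = snd p then - 1 else 2 * proj_variance)"
    proof (rule sum_mono)
      fix p assume "p \<in> index_pairs n"
      then show "(if fst p = snd p then - 1 else 2 * proj_variance)
          \<le> (\<Sum>m=1..n. expectation (\<lambda>\<omega>. Y p \<omega> * s m \<omega>))"
        using EYs_lower[of "fst p" "snd p"] by simp
    qed
    also have "(\<Sum>p\<in>index_pairs n. if fst p = snd p then - 1 else 2 * proj_variance)
        = (\<Sum>i=1..n. \<Sum>j=i..n. 2 * proj_variance - (if j = i then 1 + 2 * proj_variance else 0))"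
      unfolding sum_index_pairs by (intro sum.cong) auto
    also have "\<dots> = (\<Sum>i=1..n. 2 * proj_variance * (real n + 1 - real i) - (1 + 2 * proj_variance))"
      by (intro sum.cong refl) (auto simp: sum_subtractf sum.delta of_nat_diff algebra_simps)
    also have "\<dots> = 2 * proj_variance * (\<Sum>i=1..n. real n + 1 - real i) - real n * (1 + 2 * proj_variance)"
      by (subst sum_subtractf, subst sum_distrib_left[symmetric]) simp
    also have "(\<Sum>i=1..n. real n + 1 - real i) = real n * (real n + 1) / 2"
      by (simp add: sum_subtractf gauss algebra_simps)
    finally show ?thesis by (simp add: power2_eq_square algebra_simps)
  qed
  define U where "U = (\<lambda>\<omega>. W \<omega> - expectation W)"
  have bU: "bounded_rv M U" unfolding U_def by (intro bounded_rv_intros bW)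
  have EUS: "expectation (\<lambda>\<omega>. U \<omega> * S \<omega>) = expectation (\<lambda>\<omega>. W \<omega> * S \<omega>)"
  proof -
    have "expectation (\<lambda>\<omega>. U \<omega> * S \<omega>) = expectation (\<lambda>\<omega>. W \<omega> * S \<omega> - expectation W * S \<omega>)"
      by (simp add: U_def algebra_simps)
    also have "\<dots> = expectation (\<lambda>\<omega>. W \<omega> * S \<omega>) - expectation W * expectation S"
      by (subst Bochner_Integration.integral_diff)
         (intro integrable_bounded_rv bounded_rv_intros bW bS | simp)+
    finally show ?thesis by (simp add: ES)
  qed
  have "0 \<le> expectation (\<lambda>\<omega>. (U \<omega> - real n * S \<omega>)\<^sup>2)"
    by (intro Bochner_Integration.integral_nonneg) simp
  also have "\<dots> = expectation (\<lambda>\<omega>. ((U \<omega>)\<^sup>2 - 2 * real n * (U \<omega> * S \<omega>)) + (real n)\<^sup>2 * (S \<omega>)\<^sup>2)"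
    by (intro Bochner_Integration.integral_cong) (auto simp: power2_eq_square algebra_simps)
  also have "\<dots> = variance W - 2 * real n * expectation (\<lambda>\<omega>. W \<omega> * S \<omega>) + (real n)\<^sup>2 * (real n * proj_variance)"
    by (subst Bochner_Integration.integral_add,
        (intro integrable_bounded_rv bounded_rv_intros bU bS)+,
        subst Bochner_Integration.integral_diff,
        (intro integrable_bounded_rv bounded_rv_intros bU bS)+)
       (simp add: EUS ES2, simp add: U_def)
  finally have "variance W \<ge> 2 * real n * expectation (\<lambda>\<omega>. W \<omega> * S \<omega>) - real n ^ 3 * proj_variance"
    by (simp add: power2_eq_square power3_eq_cube mult_ac)
  moreover have "2 * real n * expectation (\<lambda>\<omega>. W \<omega> * S \<omega>)
      \<ge> 2 * real n * (proj_variance * (real n)\<^sup>2 - real n * (proj_variance + 1))"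
    by (intro mult_left_mono EWS) simp
  moreover have "W = wilcoxon X n"
    by (simp add: W_def Y_def wilcoxon_eq_pair_sum split_beta fun_eq_iff)
  ultimately show ?thesis
    by (simp add: power2_eq_square power3_eq_cube algebra_simps)
qed

text \<open>Suppose that \<open>proj\<close> is almost surely equal to its mean \<open>p\<close>. For two points \<open>x0\<close>, \<open>y\<close> where this
  value is attained, the law puts no mass on the \<open>z\<close> with \<open>y + z < 0 \<le> x0 + z\<close>, since that mass is the positive
  part of \<open>proj x0 - proj y\<close>. Averaging over \<open>y\<close> first instead turns the same double integral into the integral of
  \<open>psi (x0 + z) * (1 - proj z)\<close>, which is \<open>p * (1 - p)\<close>.\<close>

lemma mean_psi_degenerate:
  assumes "proj_variance = 0"
  shows "mean_psi = 0 \<or> mean_psi = 1"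
proof -
  have ae: "AE x in \<mu>. proj x = mean_psi"
    using assms integral_nonneg_eq_0_iff_AE[OF integrable_centred_proj_power2]
    by (simp add: proj_variance_def)
  have "\<exists>x0. proj x0 = mean_psi"
  proof (rule ccontr)
    assume "\<not> ?thesis"
    then have "AE x in \<mu>. False" using ae by simp
    then show False by simp
  qed
  then obtain x0 where x0: "proj x0 = mean_psi" ..
  let ?g = "\<lambda>y z. psi (x0 + z) * (1 - psi (y + z))"
  have g_bound: "\<bar>?g y z\<bar> \<le> 1" for y z by (simp add: psi_def)
  have "(\<integral>z. ?g y z \<partial>\<mu>) = 0" if y: "proj y = mean_psi" for y
  proof (cases "y \<ge> x0")
    case True
    then have "?g y z = 0" for z by (simp add: psi_def)
    then show ?thesis by (simp only: Bochner_Integration.integral_zero)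
  next
    case False
    then have "?g y z = psi (x0 + z) - psi (y + z)" for z by (simp add: psi_def)
    then have "(\<integral>z. ?g y z \<partial>\<mu>) = (\<integral>z. psi (x0 + z) - psi (y + z) \<partial>\<mu>)" by simp
    also have "\<dots> = proj x0 - proj y"
      unfolding proj_def by (intro Bochner_Integration.integral_diff law_integrable_bounded[of _ 1])
        (auto simp: psi_bounds)
    finally show ?thesis using x0 y by simp
  qed
  then have "(\<integral>y. (\<integral>z. ?g y z \<partial>\<mu>) \<partial>\<mu>) = (\<integral>y. 0 \<partial>\<mu>)"
    using ae by (intro integral_cong_AE) auto
  moreover have "(\<integral>y. (\<integral>z. ?g y z \<partial>\<mu>) \<partial>\<mu>) = (\<integral>z. (\<integral>y. ?g y z \<partial>\<mu>) \<partial>\<mu>)"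
    using g_bound by (intro law2.Fubini_integral[symmetric] law2.P.integrable_const_bound[of _ 1])
      (auto simp: split_beta)
  moreover have "(\<integral>y. ?g y z \<partial>\<mu>) = psi (x0 + z) * (1 - proj z)" for z
  proof -
    have "integrable \<mu> (\<lambda>y. psi (y + z))"
      by (rule law_integrable_bounded[of _ 1]) (auto simp: psi_bounds)
    then show ?thesis by (simp add: proj_def add.commute)
  qed
  moreover have "(\<integral>z. psi (x0 + z) * (1 - proj z) \<partial>\<mu>) = (\<integral>z. psi (x0 + z) * (1 - mean_psi) \<partial>\<mu>)"
    using ae by (intro integral_cong_AE) auto
  moreover have "(\<integral>z. psi (x0 + z) * (1 - mean_psi) \<partial>\<mu>) = mean_psi * (1 - mean_psi)"
    by (simp add: x0 flip: proj_def)
  ultimately have "mean_psi * (1 - mean_psi) = 0"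
    by (simp only: Bochner_Integration.integral_zero)
  then show ?thesis by simp
qed

text \<open>With \<open>p\<close> equal to \<open>0\<close> or \<open>1\<close>, an indicator with mean \<open>p\<close> has second moment \<open>0\<close> about \<open>p\<close>. The
  off-diagonal indicators have mean \<open>p\<close> by definition. For the diagonal ones, two nonnegative observations have
  a nonnegative sum and two negative observations a negative one; together with independence this
  squeezes \<open>p\<close> between \<open>r\<^sup>2\<close> and \<open>1 - (1 - r)\<^sup>2\<close>, where \<open>r\<close> is the probability of a nonnegative observation.\<close>

lemma variance_wilcoxon_degenerate:
  assumes "proj_variance = 0"
  shows "variance (wilcoxon X n) \<le> 0"
proof -
  define r where "r = (\<integral>x. psi x \<partial>\<mu>)"
  have Er: "expectation (\<lambda>\<omega>. psi (X i \<omega>)) = r" if "i \<ge> 1" for i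
    using expectation_obs[OF that, of psi] by (simp add: r_def)
  have int: "integrable M (\<lambda>\<omega>. psi (X i \<omega>))" if "i \<ge> 1" for i
    using that by (intro integrable_const_bound[of _ 1]) (auto simp: psi_bounds)
  have int2: "integrable M (\<lambda>\<omega>. psi (X 1 \<omega> + X 2 \<omega>))"
    by (intro integrable_const_bound[of _ 1]) (auto simp: psi_bounds)
  have prod: "expectation (\<lambda>\<omega>. psi (X 1 \<omega>) * psi (X 2 \<omega>)) = r\<^sup>2"
    using expectation_disjoint_pairs[of 1 1 2 2 "\<lambda>(x, y). psi x" 1 "\<lambda>(x, y). psi x" 1] Er[of 1] Er[of 2]
    by (simp add: split_beta psi_bounds power2_eq_square)
  have intp: "integrable M (\<lambda>\<omega>. psi (X 1 \<omega>) * psi (X 2 \<omega>))"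
    by (intro integrable_const_bound[of _ 1]) (auto simp: psi_def)
  have p: "expectation (\<lambda>\<omega>. psi (X 1 \<omega> + X 2 \<omega>)) = mean_psi"
    by (rule expectation_psi_pair) auto
  have lower: "r\<^sup>2 \<le> mean_psi"
    unfolding prod[symmetric] p[symmetric]
    by (intro integral_mono intp int2) (auto simp: psi_def)
  have upper: "mean_psi \<le> r + r - r\<^sup>2"
  proof -
    have "expectation (\<lambda>\<omega>. psi (X 1 \<omega> + X 2 \<omega>))
        \<le> expectation (\<lambda>\<omega>. psi (X 1 \<omega>) + psi (X 2 \<omega>) - psi (X 1 \<omega>) * psi (X 2 \<omega>))"
      using intp int2 int[of 1] int[of 2] by (intro integral_mono) (auto simp: psi_def)
    also have "\<dots> = r + r - r\<^sup>2"
      using intp int[of 1] int[of 2] Er[of 1] Er[of 2] prod by simp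
    finally show ?thesis by (simp only: p)
  qed
  have "r = mean_psi"
    using mean_psi_degenerate[OF assms]
  proof
    assume "mean_psi = 0"
    then show ?thesis using lower by simp
  next
    assume m: "mean_psi = 1"
    then have "(r - 1)\<^sup>2 \<le> 0" using upper by (simp add: power2_eq_square algebra_simps)
    then show ?thesis using m by simp
  qed
  define u where "u = (\<lambda>s. psi s - mean_psi)"
  have second_moment: "expectation (\<lambda>\<omega>. (u (Z \<omega>))\<^sup>2) \<le> 0"
    if Z: "Z \<in> borel_measurable M" and EZ: "expectation (\<lambda>\<omega>. psi (Z \<omega>)) = mean_psi" for Z
  proof -
    have "integrable M (\<lambda>\<omega>. psi (Z \<omega>))"
      using Z by (intro integrable_const_bound[of _ 1]) (auto simp: psi_bounds)
    moreover have "(u s)\<^sup>2 = (1 - 2 * mean_psi) * psi s + mean_psi\<^sup>2" for s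
      using psi_power2[of s] by (simp add: u_def power2_eq_square algebra_simps)
    ultimately have "expectation (\<lambda>\<omega>. (u (Z \<omega>))\<^sup>2) = (1 - 2 * mean_psi) * mean_psi + mean_psi\<^sup>2"
      by (simp add: EZ prob_space)
    then show ?thesis using mean_psi_degenerate[OF assms] by auto
  qed
  have "variance (\<lambda>\<omega>. \<Sum>(i, j)\<in>index_pairs n. u (X i \<omega> + X j \<omega>)) \<le> 4 * 0 * real n ^ 3"
  proof (rule variance_pair_sum_le)
    show "\<bar>u s\<bar> \<le> 1" for s
      using psi_bounds[of s] mean_psi_bounds by (simp add: u_def abs_le_iff)
    show "expectation (\<lambda>\<omega>. (u (X 1 \<omega> + X 1 \<omega>))\<^sup>2) \<le> 0"
      by (rule second_moment) (use Er[of 1] \<open>r = mean_psi\<close> in \<open>simp_all only: psi_double, simp_all\<close>)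
    show "expectation (\<lambda>\<omega>. (u (X 1 \<omega> + X 2 \<omega>))\<^sup>2) \<le> 0"
      by (rule second_moment) (use p in auto)
  qed (simp add: u_def)
  moreover have "variance (wilcoxon X n) = variance (\<lambda>\<omega>. \<Sum>(i, j)\<in>index_pairs n. u (X i \<omega> + X j \<omega>))"
  proof -
    define C where "C = real (card (index_pairs n)) * mean_psi"
    have *: "wilcoxon X n = (\<lambda>\<omega>. (\<Sum>(i, j)\<in>index_pairs n. u (X i \<omega> + X j \<omega>)) + C)"
      by (simp add: fun_eq_iff wilcoxon_eq_pair_sum u_def split_beta sum_subtractf C_def)
    show ?thesis
      unfolding * using mean_psi_bounds psi_bounds
      by (intro variance_add_const bounded_rv_sum)
         (auto simp: u_def mem_index_pairs psi_def intro!: bounded_rvI[of _ _ 1])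
  qed
  ultimately show ?thesis by simp
qed

lemma proj_variance_nonneg: "proj_variance \<ge> 0"
  unfolding proj_variance_def by (intro Bochner_Integration.integral_nonneg) simp

end

section \<open>Distribution function of a kernel\<close>

text \<open>A common source for the continuity of \<open>kernel_cdf k\<close> and its limits at infinity. The limit \<open>L\<close> of the
  indicators is needed only almost everywhere, because at the end point of the half-line they need not converge.\<close>

lemma kernel_cdf_tendsto:
  assumes k: "integrable lborel k" and L: "L \<in> borel_measurable borel"
    and lim: "AE u in lborel. (\<lambda>n. indicator {..t n} u :: real) \<longlonglongrightarrow> L u"
  shows "(\<lambda>n. kernel_cdf k (t n)) \<longlonglongrightarrow> (\<integral>u. L u * k u \<partial>lborel)"
  unfolding kernel_cdf_def set_lebesgue_integral_def real_scaleR_def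
proof (rule integral_dominated_convergence[where w = "\<lambda>u. \<bar>k u\<bar>"])
  show "AE u in lborel. (\<lambda>n. indicator {..t n} u * k u) \<longlonglongrightarrow> L u * k u"
    using lim by eventually_elim (intro tendsto_intros)
  show "AE u in lborel. norm (indicator {..t n} u * k u) \<le> \<bar>k u\<bar>" for n
    by (auto simp: indicator_def)
qed (use k L in auto)

lemma isCont_kernel_cdf:
  assumes "integrable lborel k"
  shows "isCont (kernel_cdf k) x"
  unfolding continuous_at_sequentially
proof (intro allI impI)
  fix t :: "nat \<Rightarrow> real" assume t: "t \<longlonglongrightarrow> x"
  have "(\<lambda>n. indicator {..t n} u :: real) \<longlonglongrightarrow> indicator {..x} u" if "u \<noteq> x" for u
  proof (cases "u < x")
    case True
    have "\<forall>\<^sub>F n in sequentially. indicator {..t n} u = (indicator {..x} u :: real)"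
      using order_tendstoD(1)[OF t True] by eventually_elim (use True in auto)
    then show ?thesis by (rule tendsto_eventually)
  next
    case False
    then have "x < u" using that by simp
    have "\<forall>\<^sub>F n in sequentially. indicator {..t n} u = (indicator {..x} u :: real)"
      using order_tendstoD(2)[OF t \<open>x < u\<close>] by eventually_elim (use \<open>x < u\<close> in auto)
    then show ?thesis by (rule tendsto_eventually)
  qed
  then have "AE u in lborel. (\<lambda>n. indicator {..t n} u :: real) \<longlonglongrightarrow> indicator {..x} u"
    using AE_lborel_singleton[of x] by auto
  from kernel_cdf_tendsto[OF assms _ this] show "(kernel_cdf k \<circ> t) \<longlonglongrightarrow> kernel_cdf k x"
    by (simp add: kernel_cdf_def set_lebesgue_integral_def o_def)
qed

lemma measurable_kernel_cdf:
  "integrable lborel k \<Longrightarrow> kernel_cdf k \<in> borel_measurable borel"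
  by (intro borel_measurable_continuous_onI continuous_at_imp_continuous_on ballI isCont_kernel_cdf)

lemma kernel_cdf_at_top:
  assumes k: "integrable lborel k" and t: "filterlim t at_top sequentially"
  shows "(\<lambda>n. kernel_cdf k (t n)) \<longlonglongrightarrow> (\<integral>u. k u \<partial>lborel)"
proof -
  have "(\<lambda>n. indicator {..t n} u :: real) \<longlonglongrightarrow> 1" for u
  proof (rule tendsto_eventually)
    have "\<forall>\<^sub>F n in sequentially. u \<le> t n"
      using t by (simp add: filterlim_at_top)
    then show "\<forall>\<^sub>F n in sequentially. indicator {..t n} u = (1 :: real)"
      by eventually_elim auto
  qed
  then show ?thesis using kernel_cdf_tendsto[OF k, of "\<lambda>_. 1" t] by simp
qed

lemma kernel_cdf_at_bot:
  assumes k: "integrable lborel k" and t: "filterlim t at_bot sequentially"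
  shows "(\<lambda>n. kernel_cdf k (t n)) \<longlonglongrightarrow> 0"
proof -
  have "(\<lambda>n. indicator {..t n} u :: real) \<longlonglongrightarrow> 0" for u
  proof (rule tendsto_eventually)
    have "\<forall>\<^sub>F n in sequentially. t n < u"
      using t by (simp add: filterlim_at_bot_dense)
    then show "\<forall>\<^sub>F n in sequentially. indicator {..t n} u = (0 :: real)"
      by eventually_elim auto
  qed
  then show ?thesis using kernel_cdf_tendsto[OF k, of "\<lambda>_. 0" t] by simp
qed

lemma kernel_cdf_bound:
  assumes "integrable lborel k"
  shows "\<bar>kernel_cdf k t\<bar> \<le> (\<integral>u. \<bar>k u\<bar> \<partial>lborel)"
proof -
  have "\<bar>kernel_cdf k t\<bar> \<le> (\<integral>u. \<bar>indicator {..t} u * k u\<bar> \<partial>lborel)"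
    unfolding kernel_cdf_def set_lebesgue_integral_def real_scaleR_def
    by (rule integral_abs_bound)
  also have "\<dots> \<le> (\<integral>u. \<bar>k u\<bar> \<partial>lborel)"
  proof (rule integral_mono)
    show "integrable lborel (\<lambda>u. \<bar>indicator {..t} u * k u\<bar>)"
      using integrable_mult_indicator[OF _ assms, of "{..t}"] by (intro integrable_abs) simp
    show "integrable lborel (\<lambda>u. \<bar>k u\<bar>)"
      using assms by (rule integrable_abs)
  qed (simp add: indicator_def)
  finally show ?thesis .
qed

section \<open>Error of smoothing\<close>

text \<open>The contribution of a pair with sum \<open>s\<close> to the difference between the rank statistic and its
  smoothed version: the smoothed statistic replaces \<open>psi s\<close> by \<open>1 - kernel_cdf k (- (s / (2 * h)))\<close>.\<close>

definition smoothing_error :: "(real \<Rightarrow> real) \<Rightarrow> real \<Rightarrow> real \<Rightarrow> real" where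
  "smoothing_error k h s = psi s - 1 + kernel_cdf k (- (s / (2 * h)))"

lemma measurable_smoothing_error:
  assumes "integrable lborel k"
  shows "smoothing_error k h \<in> borel_measurable borel"
proof -
  note [measurable] = measurable_kernel_cdf[OF assms]
  show ?thesis unfolding smoothing_error_def by measurable
qed

lemma smoothing_error_bound:
  assumes "integrable lborel k"
  shows "\<bar>smoothing_error k h s\<bar> \<le> 1 + (\<integral>u. \<bar>k u\<bar> \<partial>lborel)"
  using kernel_cdf_bound[OF assms, of "- (s / (2 * h))"] psi_bounds[of s]
  unfolding smoothing_error_def by linarith

text \<open>For \<open>s > 0\<close> the argument of the kernel distribution function tends to \<open>-\<infinity>\<close>, for \<open>s < 0\<close> to \<open>\<infinity>\<close>,
  where that function tends to \<open>0\<close> and \<open>1\<close> respectively; in both cases its limit is \<open>1 - psi s\<close>.\<close>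

lemma smoothing_error_tendsto_0:
  assumes k: "has_bochner_integral lborel k 1"
    and h: "h \<longlonglongrightarrow> 0" "\<forall>\<^sub>F n in sequentially. h n > 0" and s: "s \<noteq> 0"
  shows "(\<lambda>n. smoothing_error k (h n) s) \<longlonglongrightarrow> 0"
proof -
  have int: "integrable lborel k" and one: "(\<integral>u. k u \<partial>lborel) = 1"
    using k by (auto simp: has_bochner_integral_iff)
  have h2: "filterlim (\<lambda>n. 2 * h n) (at_right 0) sequentially"
    using tendsto_mult[OF tendsto_const[of 2] h(1)] h(2)
    by (intro tendsto_imp_filterlim_at_right) simp_all
  have inv: "filterlim (\<lambda>n. inverse (2 * h n)) at_top sequentially"
    by (rule filterlim_compose[OF filterlim_inverse_at_top_right h2])
  have "(\<lambda>n. kernel_cdf k (- (s / (2 * h n)))) \<longlonglongrightarrow> 1 - psi s"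
  proof (cases "s > 0")
    case True
    have "filterlim (\<lambda>n. - (s / (2 * h n))) at_bot sequentially"
      unfolding divide_inverse filterlim_uminus_at_top[symmetric]
      by (rule filterlim_tendsto_pos_mult_at_top[OF tendsto_const True inv])
    moreover have "1 - psi s = 0" using True by (simp add: psi_def)
    ultimately show ?thesis by (simp only: kernel_cdf_at_bot[OF int])
  next
    case False
    then have "- s > 0" using s by simp
    have "filterlim (\<lambda>n. - (s / (2 * h n))) at_top sequentially"
      unfolding divide_inverse mult_minus_left[symmetric]
      by (rule filterlim_tendsto_pos_mult_at_top[OF tendsto_const \<open>- s > 0\<close> inv])
    from kernel_cdf_at_top[OF int this] have "(\<lambda>n. kernel_cdf k (- (s / (2 * h n)))) \<longlonglongrightarrow> 1"
      by (simp only: one)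
    moreover have "1 - psi s = 1" using \<open>- s > 0\<close> by (simp add: psi_def)
    ultimately show ?thesis by (simp only:)
  qed
  from tendsto_add[OF tendsto_const[of "psi s - 1"] this] show ?thesis
    unfolding smoothing_error_def by simp
qed

lemma (in prob_space) smoothing_error_second_moment_tendsto_0:
  assumes k: "has_bochner_integral lborel k 1"
    and h: "h \<longlonglongrightarrow> 0" "\<forall>\<^sub>F n in sequentially. h n > 0"
    and Z [measurable]: "Z \<in> borel_measurable M" and nz: "AE \<omega> in M. Z \<omega> \<noteq> 0"
  shows "(\<lambda>n. expectation (\<lambda>\<omega>. (smoothing_error k (h n) (Z \<omega>))\<^sup>2)) \<longlonglongrightarrow> 0"
proof -
  let ?B = "1 + (\<integral>u. \<bar>k u\<bar> \<partial>lborel)"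
  have int: "integrable lborel k"
    using k by (auto simp: has_bochner_integral_iff)
  note [measurable] = measurable_smoothing_error[OF int]
  have "(\<lambda>n. expectation (\<lambda>\<omega>. (smoothing_error k (h n) (Z \<omega>))\<^sup>2)) \<longlonglongrightarrow> expectation (\<lambda>\<omega>. 0)"
  proof (rule integral_dominated_convergence[where w = "\<lambda>_. ?B\<^sup>2"])
    show "AE \<omega> in M. (\<lambda>n. (smoothing_error k (h n) (Z \<omega>))\<^sup>2) \<longlonglongrightarrow> 0"
      using nz
    proof eventually_elim
      case (elim \<omega>)
      from tendsto_power[OF smoothing_error_tendsto_0[OF k h elim], of 2] show ?case by simp
    qed
    show "AE \<omega> in M. norm ((smoothing_error k (h n) (Z \<omega>))\<^sup>2) \<le> ?B\<^sup>2" for n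
    proof (rule AE_I2)
      fix \<omega>
      from power_mono[OF smoothing_error_bound[OF int, of "h n" "Z \<omega>"] abs_ge_zero, of 2]
      show "norm ((smoothing_error k (h n) (Z \<omega>))\<^sup>2) \<le> ?B\<^sup>2" by simp
    qed
  qed simp_all
  then show ?thesis by simp
qed

lemma (in iid_sample) AE_sum_nonzero:
  assumes "\<And>x. measure \<mu> {x} = 0"
  shows "AE \<omega> in M. X 1 \<omega> + X 2 \<omega> \<noteq> 0"
proof -
  let ?I = "\<lambda>\<omega>. indicator {0} (X 1 \<omega> + X 2 \<omega>) :: real"
  have "expectation ?I = (\<integral>x. (\<integral>y. indicator {0} (x + y) \<partial>\<mu>) \<partial>\<mu>)"
    using expectation_pair[of 1 2 "\<lambda>(x, y). indicator {0} (x + y)" 1] by (simp add: split_beta)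
  also have "\<dots> = (\<integral>x. measure \<mu> {- x} \<partial>\<mu>)"
  proof (intro Bochner_Integration.integral_cong refl)
    fix x :: real
    have "(\<lambda>y. indicator {0} (x + y) :: real) = indicator {- x}"
      by (intro ext) (simp add: indicator_def add_eq_0_iff)
    then show "(\<integral>y. indicator {0} (x + y) \<partial>\<mu>) = measure \<mu> {- x}" by simp
  qed
  also have "\<dots> = 0" by (simp add: assms)
  finally have "AE \<omega> in M. ?I \<omega> = 0"
    by (subst integral_nonneg_eq_0_iff_AE[symmetric]) (auto intro!: integrable_const_bound[of _ 1])
  then show ?thesis by eventually_elim (auto simp: indicator_def split: if_splits)
qed

lemma (in iid_sample) AE_obs_nonzero:
  assumes "\<And>x. measure \<mu> {x} = 0"
  shows "AE \<omega> in M. X 1 \<omega> + X 1 \<omega> \<noteq> 0"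
proof -
  have "AE x in \<mu>. x \<noteq> 0"
    using assms[of 0] by (subst AE_iff_measurable[of "{0}"]) (auto simp: law.emeasure_eq_measure)
  then have "AE x in distr M borel (X 1). x \<noteq> 0"
    by (subst law) simp_all
  then show ?thesis by (subst (asm) AE_distr_iff) auto
qed

section \<open>Equivalence of the standardized statistics\<close>

theorem theorem6:
  fixes M :: "'a measure" and X :: "nat \<Rightarrow> 'a \<Rightarrow> real"
    and F f k :: "real \<Rightarrow> real" and h :: "nat \<Rightarrow> real" and \<theta> c d :: real
  assumes "prob_space M"
    and indep: "prob_space.indep_vars M (\<lambda>_. borel) X {1..}"
    and distribution: "\<And>i x. i \<ge> 1 \<Longrightarrow> cdf (distr M borel (X i)) x = F (x - \<theta>)"
    and f_nonneg: "\<And>x. f x \<ge> 0"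
    and f_density: "has_bochner_integral lborel f 1"
    and F_density: "\<And>x. F x = (LBINT t:{..x}. f t)"
    and f_symmetric: "\<And>x. f (- x) = f x"
    and f_C1: "\<exists>U f'. open U \<and> - \<theta> \<in> U \<and>
                 (\<forall>x\<in>U. (f has_real_derivative f' x) (at x)) \<and> continuous_on U f'"
    and k_integral: "has_bochner_integral lborel k 1"
    and k_symmetric: "\<And>u. k (- u) = k u"
    and "c > 0" and "1 / 4 < d" and "d < 1 / 2"
    and bandwidth: "\<And>n. n \<ge> 1 \<Longrightarrow> h n = c * real n powr (- d)"
    and nondegenerate: "\<forall>\<^sub>F n in sequentially. prob_space.variance M (wilcoxon X n) > 0"
  shows "(\<lambda>n. prob_space.expectation M (\<lambda>\<omega>.
            (standardized M (wilcoxon X n) \<omega>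
             - standardized M (smoothed_wilcoxon k (h n) X n) \<omega>)\<^sup>2))
         \<longlonglongrightarrow> 0"
proof -
  interpret prob_space M by fact
  define \<mu> where "\<mu> = distr M borel (X 1)"
  have X: "X i \<in> borel_measurable M" if "i \<ge> 1" for i
    using indep that by (auto simp: indep_vars_def)
  have real_dist: "real_distribution (distr M borel (X i))" if "i \<ge> 1" for i
    using X[OF that] by simp
  have "distr M borel (X i) = \<mu>" if "i \<ge> 1" for i
    unfolding \<mu>_def using distribution that
    by (intro cdf_unique real_dist) (auto simp: fun_eq_iff)
  then interpret iid_sample M X \<mu>
    by unfold_locales (use indep in auto)
  interpret \<mu>: real_distribution \<mu>
    unfolding \<mu>_def by (rule real_dist) simp
  \<comment> \<open>The distribution function is a primitive of an integrable function, like that of a kernel,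
    and hence continuous.\<close>
  have atomless: "measure \<mu> {x} = 0" for x
  proof -
    have "cdf \<mu> = (\<lambda>x. kernel_cdf f (x - \<theta>))"
      using distribution[of 1] F_density by (simp add: \<mu>_def kernel_cdf_def fun_eq_iff)
    moreover have "isCont (\<lambda>x. kernel_cdf f (x - \<theta>)) x"
      by (rule isCont_o2[OF _ isCont_kernel_cdf])
        (use f_density in \<open>simp_all add: has_bochner_integral_iff\<close>)
    ultimately show ?thesis using \<mu>.isCont_cdf by simp
  qed
  have k: "integrable lborel k"
    using k_integral by (auto simp: has_bochner_integral_iff)
  note [measurable] = measurable_smoothing_error[OF k] measurable_kernel_cdf[OF k]
  have h_pos: "\<forall>\<^sub>F n in sequentially. h n > 0"
    using eventually_ge_at_top[of 1] by eventually_elim (use \<open>c > 0\<close> bandwidth in auto)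
  have h_0: "h \<longlonglongrightarrow> 0"
  proof -
    have "(\<lambda>n. c * real n powr (- d)) \<longlonglongrightarrow> c * 0"
      by (intro tendsto_mult tendsto_const tendsto_neg_powr filterlim_real_sequentially)
        (use \<open>1 / 4 < d\<close> in simp)
    moreover have "\<forall>\<^sub>F n in sequentially. c * real n powr (- d) = h n"
      using eventually_ge_at_top[of 1] by eventually_elim (simp add: bandwidth)
    ultimately show ?thesis by (simp add: tendsto_cong)
  qed

  define W where "W = (\<lambda>n. wilcoxon X n)"
  define V where "V = (\<lambda>n. smoothed_wilcoxon k (h n) X n)"
  define e where "e = (\<lambda>n. max (expectation (\<lambda>\<omega>. (smoothing_error k (h n) (X 1 \<omega> + X 1 \<omega>))\<^sup>2))
      (expectation (\<lambda>\<omega>. (smoothing_error k (h n) (X 1 \<omega> + X 2 \<omega>))\<^sup>2)))"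
  have "e \<longlonglongrightarrow> max 0 0"
    unfolding e_def
    by (intro tendsto_max smoothing_error_second_moment_tendsto_0 k_integral h_0 h_pos
        AE_obs_nonzero AE_sum_nonzero atomless) simp_all
  then have e: "e \<longlonglongrightarrow> 0" by simp
  have bW: "bounded_rv M (W n)" for n
    unfolding W_def wilcoxon_eq_pair_sum[abs_def]
    by (intro bounded_rv_sum) (auto simp: mem_index_pairs psi_bounds intro!: bounded_rvI[of _ _ 1])
  have bV: "bounded_rv M (V n)" for n
    unfolding V_def smoothed_wilcoxon_def[abs_def]
    by (intro bounded_rv_diff bounded_rv_const bounded_rv_sum bounded_rvI[OF _ kernel_cdf_bound[OF k]]) auto
  have var_diff: "variance (\<lambda>\<omega>. W n \<omega> - V n \<omega>) \<le> 4 * e n * real n ^ 3" for n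
  proof -
    let ?D = "\<lambda>\<omega>. \<Sum>(i, j)\<in>index_pairs n. smoothing_error k (h n) (X i \<omega> + X j \<omega>)"
    define C where "C = real (card (index_pairs n)) - real n * (real n + 1) / 2"
    have *: "W n \<omega> - V n \<omega> = ?D \<omega> + C" for \<omega>
      unfolding W_def V_def wilcoxon_eq_pair_sum smoothed_wilcoxon_def sum_index_pairs
      by (simp add: C_def smoothing_error_def split_beta sum.distrib sum_subtractf)
    have "bounded_rv M ?D"
      by (intro bounded_rv_sum)
        (auto simp: mem_index_pairs intro!: bounded_rvI[OF _ smoothing_error_bound[OF k]])
    then have "variance (\<lambda>\<omega>. W n \<omega> - V n \<omega>) = variance ?D"
      unfolding * by (rule variance_add_const)
    also have "\<dots> \<le> 4 * e n * real n ^ 3"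
      by (rule variance_pair_sum_le[OF _ smoothing_error_bound[OF k]]) (auto simp: e_def)
    finally show ?thesis .
  qed
  have pos: "proj_variance > 0"
  proof (rule ccontr)
    assume "\<not> proj_variance > 0"
    then have "proj_variance = 0" using proj_variance_nonneg by simp
    then have "\<not> variance (wilcoxon X n) > 0" for n
      by (simp only: not_less variance_wilcoxon_degenerate)
    then have "\<forall>\<^sub>F n in sequentially. False"
      using nondegenerate by (simp only:)
    then show False by simp
  qed
  \<comment> \<open>The threshold makes the error term \<open>2 * n\<^sup>2 * (proj_variance + 1)\<close> in the lower bound for
    \<open>Var W\<close> at most half of the leading term.\<close>
  have bound: "\<forall>\<^sub>F n in sequentially. expectation (\<lambda>\<omega>. (standardized M (W n) \<omega> - standardized M (V n) \<omega>)\<^sup>2)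
      \<le> 32 / proj_variance * e n"
    using nondegenerate eventually_ge_at_top[of 1]
      eventually_ge_at_top[of "nat \<lceil>4 * (proj_variance + 1) / proj_variance\<rceil>"]
  proof eventually_elim
    case (elim n)
    then have "real n \<ge> 4 * (proj_variance + 1) / proj_variance" by linarith
    then have "real n * proj_variance \<ge> 4 * (proj_variance + 1)"
      using pos by (simp add: field_simps)
    then have "(real n)\<^sup>2 * (real n * proj_variance) \<ge> (real n)\<^sup>2 * (4 * (proj_variance + 1))"
      by (intro mult_left_mono) auto
    moreover have "(real n)\<^sup>2 * (real n * proj_variance) = real n ^ 3 * proj_variance"
      by (simp add: power2_eq_square power3_eq_cube)
    moreover have "(real n)\<^sup>2 * (4 * (proj_variance + 1)) = 2 * (2 * (real n)\<^sup>2 * (proj_variance + 1))"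
      by simp
    ultimately have W_ge: "variance (W n) \<ge> real n ^ 3 * proj_variance / 2"
      unfolding W_def by (intro order_trans[OF _ variance_wilcoxon_ge]) linarith
    have "expectation (\<lambda>\<omega>. (standardized M (W n) \<omega> - standardized M (V n) \<omega>)\<^sup>2)
        \<le> 4 * variance (\<lambda>\<omega>. W n \<omega> - V n \<omega>) / variance (W n)"
      by (rule standardized_diff_le[OF bW bV]) (use elim in \<open>simp add: W_def\<close>)
    also have "\<dots> \<le> 4 * (4 * e n * real n ^ 3) / (real n ^ 3 * proj_variance / 2)"
    proof (rule frac_le)
      show "0 \<le> 4 * (4 * e n * real n ^ 3)"
        using order_trans[OF variance_positive var_diff[of n]] by simp
    qed (use var_diff[of n] W_ge pos elim in simp_all)
    also have "\<dots> = 32 / proj_variance * e n"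
      using pos elim by simp
    finally show ?case .
  qed
  have "(\<lambda>n. 32 / proj_variance * e n) \<longlonglongrightarrow> 32 / proj_variance * 0"
    by (intro tendsto_intros e)
  then have "(\<lambda>n. expectation (\<lambda>\<omega>. (standardized M (W n) \<omega> - standardized M (V n) \<omega>)\<^sup>2)) \<longlonglongrightarrow> 0"
    by (intro tendsto_sandwich[OF _ bound tendsto_const] always_eventually allI
        Bochner_Integration.integral_nonneg) simp_all
  then show ?thesis unfolding W_def V_def .
qed

end
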